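(* Let $L>0$ and let $\mathcal A$ be a nonadaptive horizon-independent linear-span method with coefficients $(\beta_{i,k})_{0\le i<k}$. Let $s_0:=0$, $s_k:=\sum_{i=0}^{k-1}\beta_{i,k}$ for $k\ge1$, $B_k:=\max_{0\le i\le k}s_i$, and $\Delta_k:=B_k-B_{k-1}$ for $k\ge1$. If the record displacements have regular growth, i.e. there is some $a\ge0$ with $B_N/N\to a$ and $\Delta_N\to a$ as $N\to\infty$, then $$\liminf_{N\to\infty}N\,\mathcal G_N(\mathcal A)\ge\frac12 .$$
   Context: Fix $L>0$. $\mathcal F_{0,L}(\mathbb R^d)$ is the class of convex differentiable functions $f:\mathbb R^d\to\mathbb R$ that admit a minimizer and whose gradient is $L$-Lipschitz (Euclidean norm); $f_\star:=\min f$. A nonadaptive horizon-independent linear-span method $\mathcal A$ is given by a single infinite array of real coefficients $(\beta_{i,k})_{0\le i<k}$, fixed in advance (independent of $f$, of $x_0$, of the dimension, of all observed gradients, and of any stopping horizon). Applied to $f$ and $x_0$ it generates $x_k=x_0-\frac1L\sum_{i=0}^{k-1}\beta_{i,k}\nabla f(x_i)$, $k\ge1$. Its worst-case bound after $N$ iterations is $$\mathcal G_N(\mathcal A):=\sup_{d\ge1,\ f\in\mathcal F_{0,L}(\mathbb R^d),\ x_0\in\mathbb R^d,\ f(x_0)>f_\star}\frac{\|\nabla f(x_N)\|^2}{L(f(x_0)-f_\star)}.$$ *)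

theory Defs
  imports "HOL-Analysis.Analysis"
begin

text \<open>
  The supremum in the worst-case bound ranges over all dimensions, so the dimension has to be a term.
  The space of dimension \<open>d\<close> is the carrier of the library's \<^const>\<open>Euclidean_space\<close> \<open>d\<close>, that is, the
  real sequences vanishing from index \<open>d\<close> on. Objective functions are HOL functions on all
  sequences; only their values on this carrier matter below.
\<close>

abbreviation Rn :: "nat \<Rightarrow> (nat \<Rightarrow> real) set" where
  "Rn d \<equiv> topspace (Euclidean_space d)"

abbreviation norm_Rn :: "nat \<Rightarrow> (nat \<Rightarrow> real) \<Rightarrow> real" where
  "norm_Rn d x \<equiv> L2_set x {..<d}"

definition has_gradient_Rn ::
  "nat \<Rightarrow> ((nat \<Rightarrow> real) \<Rightarrow> real) \<Rightarrow> (nat \<Rightarrow> real) \<Rightarrow> (nat \<Rightarrow> real) \<Rightarrow> bool" where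
  "has_gradient_Rn d f x g \<longleftrightarrow> g \<in> Rn d \<and>
     (\<forall>\<epsilon>>0. \<exists>\<delta>>0. \<forall>h\<in>Rn d. norm_Rn d h < \<delta> \<longrightarrow>
        \<bar>f (\<lambda>j. x j + h j) - f x - (\<Sum>j<d. g j * h j)\<bar> \<le> \<epsilon> * norm_Rn d h)"

lemma has_gradient_Rn_unique:
  assumes "has_gradient_Rn d f x g" "has_gradient_Rn d f x g'"
  shows "g = g'"
proof -
  define v where "v = (\<lambda>j. g j - g' j)"
  have g: "g \<in> Rn d" "g' \<in> Rn d" using assms by (auto simp: has_gradient_Rn_def)
  have "norm_Rn d v \<le> 0"
  proof (rule ccontr)
    assume "\<not> norm_Rn d v \<le> 0"
    then have v: "norm_Rn d v > 0" by simp
    define e where "e = norm_Rn d v / 4"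
    have e: "e > 0" using v by (simp add: e_def)
    obtain d1 where d1: "d1 > 0" "\<And>h. h \<in> Rn d \<Longrightarrow> norm_Rn d h < d1 \<Longrightarrow>
        \<bar>f (\<lambda>j. x j + h j) - f x - (\<Sum>j<d. g j * h j)\<bar> \<le> e * norm_Rn d h"
      using assms(1) e unfolding has_gradient_Rn_def by meson
    obtain d2 where d2: "d2 > 0" "\<And>h. h \<in> Rn d \<Longrightarrow> norm_Rn d h < d2 \<Longrightarrow>
        \<bar>f (\<lambda>j. x j + h j) - f x - (\<Sum>j<d. g' j * h j)\<bar> \<le> e * norm_Rn d h"
      using assms(2) e unfolding has_gradient_Rn_def by meson
    define t where "t = min d1 d2 / (2 * norm_Rn d v)"
    have t: "t > 0" using d1(1) d2(1) v by (simp add: t_def)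
    define h where "h = (\<lambda>j. t * v j)"
    have h: "h \<in> Rn d" using g by (auto simp: h_def v_def topspace_Euclidean_space)
    have nh: "norm_Rn d h = t * norm_Rn d v"
      using t by (simp add: h_def L2_set_right_distrib)
    have "norm_Rn d h = min d1 d2 / 2" using v by (simp add: nh t_def)
    then have "norm_Rn d h < d1" "norm_Rn d h < d2" using d1(1) d2(1) by linarith+
    from d1(2)[OF h this(1)] d2(2)[OF h this(2)]
    have "\<bar>(\<Sum>j<d. g j * h j) - (\<Sum>j<d. g' j * h j)\<bar> \<le> 2 * e * norm_Rn d h" by linarith
    also have "(\<Sum>j<d. g j * h j) - (\<Sum>j<d. g' j * h j) = t * (\<Sum>j<d. (v j)\<^sup>2)"
      by (simp add: h_def v_def sum_subtractf[symmetric] sum_distrib_left power2_eq_square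
          algebra_simps)
    also have "(\<Sum>j<d. (v j)\<^sup>2) = (norm_Rn d v)\<^sup>2"
      by (simp add: L2_set_def sum_nonneg)
    finally have "t * (norm_Rn d v)\<^sup>2 \<le> 2 * e * (t * norm_Rn d v)"
      using t by (simp add: nh)
    also have "\<dots> = t * (norm_Rn d v)\<^sup>2 / 2" by (simp add: e_def power2_eq_square)
    finally show False using t v by simp
  qed
  then have "norm_Rn d v = 0" using L2_set_nonneg[of v "{..<d}"] by linarith
  then have "\<forall>j<d. v j = 0" by (simp add: L2_set_eq_0_iff)
  then show ?thesis
    using g by (auto simp: v_def topspace_Euclidean_space not_less intro!: ext)
      (metis eq_iff_diff_eq_0 not_less)
qed

definition gradient_Rn ::
  "nat \<Rightarrow> ((nat \<Rightarrow> real) \<Rightarrow> real) \<Rightarrow> (nat \<Rightarrow> real) \<Rightarrow> (nat \<Rightarrow> real)" where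
  "gradient_Rn d f x = (THE g. has_gradient_Rn d f x g)"

definition smooth_convex :: "real \<Rightarrow> nat \<Rightarrow> ((nat \<Rightarrow> real) \<Rightarrow> real) set" where
  "smooth_convex L d = {f.
     (\<forall>x\<in>Rn d. \<forall>y\<in>Rn d. \<forall>t\<in>{0..1}.
        f (\<lambda>j. (1 - t) * x j + t * y j) \<le> (1 - t) * f x + t * f y) \<and>
     (\<forall>x\<in>Rn d. \<exists>g. has_gradient_Rn d f x g) \<and>
     (\<exists>x\<in>Rn d. \<forall>y\<in>Rn d. f x \<le> f y) \<and>
     (\<forall>x\<in>Rn d. \<forall>y\<in>Rn d.
        norm_Rn d (\<lambda>j. gradient_Rn d f x j - gradient_Rn d f y j)
          \<le> L * norm_Rn d (\<lambda>j. x j - y j))}"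

definition min_value :: "nat \<Rightarrow> ((nat \<Rightarrow> real) \<Rightarrow> real) \<Rightarrow> real" where
  "min_value d f = (INF x\<in>Rn d. f x)"

text \<open>
  A method is its coefficient array \<open>\<beta>\<close>; only the entries \<open>\<beta> i k\<close> with \<open>i < k\<close> are ever used.
  The recursion covers \<open>k = 0\<close> as well, where the sum is empty.
\<close>

function iterate ::
  "real \<Rightarrow> (nat \<Rightarrow> nat \<Rightarrow> real) \<Rightarrow> nat \<Rightarrow> ((nat \<Rightarrow> real) \<Rightarrow> real) \<Rightarrow> (nat \<Rightarrow> real) \<Rightarrow> nat
    \<Rightarrow> (nat \<Rightarrow> real)" where
  "iterate L \<beta> d f x0 k =
     (\<lambda>j. x0 j - 1 / L * (\<Sum>i<k. \<beta> i k * gradient_Rn d f (iterate L \<beta> d f x0 i) j))"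
  by pat_completeness auto
termination
  by (relation "Wellfounded.measure (\<lambda>(L, \<beta>, d, f, x0, k). k)") auto

declare iterate.simps [simp del]

definition worst_case :: "real \<Rightarrow> (nat \<Rightarrow> nat \<Rightarrow> real) \<Rightarrow> nat \<Rightarrow> ereal" where
  "worst_case L \<beta> N = Sup {ereal ((norm_Rn d (gradient_Rn d f (iterate L \<beta> d f x0 N)))\<^sup>2
                                    / (L * (f x0 - min_value d f))) | d f x0.
     1 \<le> d \<and> f \<in> smooth_convex L d \<and> x0 \<in> Rn d \<and> f x0 > min_value d f}"

definition displacement :: "(nat \<Rightarrow> nat \<Rightarrow> real) \<Rightarrow> nat \<Rightarrow> real" where
  "displacement \<beta> k = (\<Sum>i<k. \<beta> i k)"

definition record_disp :: "(nat \<Rightarrow> nat \<Rightarrow> real) \<Rightarrow> nat \<Rightarrow> real" where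
  "record_disp \<beta> k = Max (displacement \<beta> ` {0..k})"

text \<open>Meaningful for \<open>k \<ge> 1\<close>; the value at \<open>0\<close> is irrelevant to the limit.\<close>

definition record_increment :: "(nat \<Rightarrow> nat \<Rightarrow> real) \<Rightarrow> nat \<Rightarrow> real" where
  "record_increment \<beta> k = record_disp \<beta> k - record_disp \<beta> (k - 1)"

end

theory Submission
  imports Defs
begin

text \<open>
  One-dimensional functions suffice. Up to the factor \<open>L\<close>, take the one-sided Huber function, with
  derivative \<open>min t 1\<close>. As long as all previous iterates are \<open>\<ge> 1\<close>, all observed gradients equal \<open>1\<close>,
  so the \<open>k\<close>-th iterate is the starting point minus \<open>s\<^sub>k\<close>. Starting from \<open>1 + B\<^sub>N\<close>, the gradient at
  time \<open>N\<close> is still \<open>1\<close>, which gives \<open>\<G>\<^sub>N \<ge> 1 / (B\<^sub>N + 1/2)\<close> and settles \<open>a \<le> 2\<close>. Starting from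
  \<open>1 + B\<^bsub>N-1\<^esub>\<close>, a record step at time \<open>N\<close> overshoots to \<open>1 - \<Delta>\<^sub>N\<close>, so
  \<open>\<G>\<^sub>N \<ge> (1 - \<Delta>\<^sub>N)\<^sup>2 / (B\<^bsub>N-1\<^esub> + 1/2)\<close>; this settles \<open>a > 2\<close>, where all late steps are record steps
  and \<open>(a - 1)\<^sup>2 / a \<ge> 1/2\<close>.
\<close>

section \<open>The one-sided Huber function on the real line\<close>

definition huber :: "real \<Rightarrow> real" where
  "huber t = (if t \<le> 1 then t\<^sup>2 / 2 else t - 1 / 2)"

lemma huber_nonneg: "huber t \<ge> 0"
  by (simp add: huber_def)

lemma huber_ge_1: "t \<ge> 1 \<Longrightarrow> huber t = t - 1 / 2"
  by (auto simp: huber_def)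

lemma huber_tangent_le: "huber x + min x 1 * (y - x) \<le> huber y"
proof -
  have sq: "0 \<le> (y - x)\<^sup>2" "0 \<le> (y - 1)\<^sup>2" by simp_all
  \<comment> \<open>Across the kink the gap is half this product; in the other cases it is half a
    square or zero.\<close>
  have "0 \<le> (1 - x) * (2 * y - x - 1)" if "x \<le> 1" "1 < y"
    using that by (intro mult_nonneg_nonneg) auto
  then show ?thesis
    using sq by (auto simp: huber_def min_def power2_eq_square field_simps)
qed

lemma huber_le_quadratic: "huber y \<le> huber x + min x 1 * (y - x) + (y - x)\<^sup>2 / 2"
proof -
  have sq: "0 \<le> (y - x)\<^sup>2" "0 \<le> (y - 1)\<^sup>2" by simp_all
  have "0 \<le> (x - 1) * (x + 1 - 2 * y)" if "1 < x" "y \<le> 1"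
    using that by (intro mult_nonneg_nonneg) auto
  then show ?thesis
    using sq by (auto simp: huber_def min_def power2_eq_square field_simps)
qed

text \<open>Weight the tangent bounds at the convex combination \<open>z\<close>; the slope terms
  cancel.\<close>

lemma huber_convex:
  assumes "t \<in> {0..1}"
  shows "huber ((1 - t) * x + t * y) \<le> (1 - t) * huber x + t * huber y"
proof -
  define z where "z = (1 - t) * x + t * y"
  have "(1 - t) * (huber z + min z 1 * (x - z)) + t * (huber z + min z 1 * (y - z))
      \<le> (1 - t) * huber x + t * huber y"
    using assms by (intro add_mono mult_left_mono huber_tangent_le) auto
  moreover have "(1 - t) * (huber z + min z 1 * (x - z)) + t * (huber z + min z 1 * (y - z))
      = huber z + min z 1 * ((1 - t) * x + t * y - z)"
    by (simp add: algebra_simps)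
  ultimately show ?thesis by (simp add: z_def)
qed

section \<open>The scaled Huber function in dimension one and the method's run on it\<close>

definition line_point :: "real \<Rightarrow> nat \<Rightarrow> real" where
  "line_point t = (\<lambda>j. if j = 0 then t else 0)"

lemma line_point_0 [simp]: "line_point t 0 = t"
  by (simp add: line_point_def)

lemma line_point_in_Rn: "line_point t \<in> Rn 1"
  by (simp add: line_point_def topspace_Euclidean_space)

lemma norm_Rn_Suc_0 [simp]: "norm_Rn (Suc 0) x = \<bar>x 0\<bar>"
  by (simp add: L2_set_def)

definition line_huber :: "real \<Rightarrow> (nat \<Rightarrow> real) \<Rightarrow> real" where
  "line_huber L x = L * huber (x 0)"

lemma has_gradient_line_huber:
  assumes "L > 0"
  shows "has_gradient_Rn 1 (line_huber L) x (line_point (L * min (x 0) 1))"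
  unfolding has_gradient_Rn_def
proof (intro conjI allI impI line_point_in_Rn)
  fix e :: real assume e: "e > 0"
  show "\<exists>d>0. \<forall>h\<in>Rn 1. norm_Rn 1 h < d \<longrightarrow>
        \<bar>line_huber L (\<lambda>j. x j + h j) - line_huber L x
          - (\<Sum>j<1. line_point (L * min (x 0) 1) j * h j)\<bar> \<le> e * norm_Rn 1 h"
  \<comment> \<open>The remainder is at most L * h^2, hence at most e * |h| once |h| < e /
    L.\<close>
  proof (intro exI[of _ "e / L"] conjI ballI impI)
    fix h assume h: "norm_Rn 1 h < e / L"
    define r where "r = huber (x 0 + h 0) - huber (x 0) - min (x 0) 1 * h 0"
    have "0 \<le> r" "r \<le> (h 0)\<^sup>2 / 2"
      using huber_tangent_le[of "x 0" "x 0 + h 0"] huber_le_quadratic[of "x 0 + h 0" "x 0"]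
      by (simp_all add: r_def)
    then have "\<bar>L * r\<bar> \<le> L * (h 0)\<^sup>2"
      using assms by (simp add: abs_mult)
    also have "\<dots> = (L * \<bar>h 0\<bar>) * \<bar>h 0\<bar>"
      by (simp add: power2_eq_square)
    also have "\<dots> \<le> e * \<bar>h 0\<bar>"
      using h assms by (intro mult_right_mono) (auto simp: field_simps)
    finally show "\<bar>line_huber L (\<lambda>j. x j + h j) - line_huber L x
          - (\<Sum>j<1. line_point (L * min (x 0) 1) j * h j)\<bar> \<le> e * norm_Rn 1 h"
      by (simp add: r_def line_huber_def algebra_simps)
  qed (use e assms in simp)
qed

lemma gradient_line_huber:
  "L > 0 \<Longrightarrow> gradient_Rn 1 (line_huber L) x = line_point (L * min (x 0) 1)"
  unfolding gradient_Rn_def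
  using has_gradient_line_huber has_gradient_Rn_unique by blast

lemma line_huber_minimum:
  assumes "L > 0"
  shows "line_huber L (line_point 0) \<le> line_huber L x"
  using assms huber_nonneg by (simp add: line_huber_def huber_def)

lemma line_huber_smooth_convex:
  assumes "L > 0"
  shows "line_huber L \<in> smooth_convex L 1"
proof -
  have "line_huber L (\<lambda>j. (1 - t) * x j + t * y j)
      \<le> (1 - t) * line_huber L x + t * line_huber L y" if "t \<in> {0..1}" for x y t
    using mult_left_mono[OF huber_convex[OF that], of L "x 0" "y 0"] assms
    by (simp add: line_huber_def algebra_simps)
  moreover have "\<bar>L * min (x 0) 1 - L * min (y 0) 1\<bar> \<le> L * \<bar>x 0 - y 0\<bar>" for x y :: "nat \<Rightarrow> real"
  proof -
    have "\<bar>L * min (x 0) 1 - L * min (y 0) 1\<bar> = L * \<bar>min (x 0) 1 - min (y 0) 1\<bar>"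
      using assms by (simp add: abs_mult flip: right_diff_distrib)
    also have "\<dots> \<le> L * \<bar>x 0 - y 0\<bar>"
      using assms by (intro mult_left_mono) auto
    finally show ?thesis .
  qed
  moreover have "\<exists>g. has_gradient_Rn 1 (line_huber L) x g" for x
    using has_gradient_line_huber[OF assms] by blast
  moreover have "\<exists>x\<in>Rn 1. \<forall>y\<in>Rn 1. line_huber L x \<le> line_huber L y"
    using line_huber_minimum[OF assms] line_point_in_Rn by blast
  ultimately show ?thesis
    unfolding smooth_convex_def
    by (simp add: gradient_line_huber[OF assms, unfolded One_nat_def])
qed

lemma min_value_line_huber:
  assumes "L > 0"
  shows "min_value 1 (line_huber L) = 0"
proof -
  have "min_value 1 (line_huber L) = line_huber L (line_point 0)"
    unfolding min_value_def
    using line_huber_minimum[OF assms] line_point_in_Rn by (intro cInf_eq_minimum) auto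
  then show ?thesis by (simp add: line_huber_def huber_def)
qed

text \<open>Every earlier iterate sees the gradient \<open>L\<close>, which cancels the step factor
  1/L. Only indices below \<open>k\<close> are constrained: the \<open>k\<close>-th iterate itself
  may leave the linear piece.\<close>

lemma iterate_line_huber:
  assumes "L > 0" "\<And>i. i < k \<Longrightarrow> displacement \<beta> i + 1 \<le> t"
  shows "iterate L \<beta> 1 (line_huber L) (line_point t) k = line_point (t - displacement \<beta> k)"
  using assms(2)
proof (induction k rule: less_induct)
  case (less k)
  have "gradient_Rn 1 (line_huber L) (iterate L \<beta> 1 (line_huber L) (line_point t) i)
      = line_point L" if "i < k" for i
  proof -
    have "min (t - displacement \<beta> i) 1 = 1" using less.prems[OF that] by simp
    then show ?thesis
      using less.IH[of i] less.prems that assms(1)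
      by (simp add: gradient_line_huber del: One_nat_def)
  qed
  then have "iterate L \<beta> 1 (line_huber L) (line_point t) k j
      = line_point t j - 1 / L * (\<Sum>i<k. \<beta> i k * line_point L j)" for j
    by (subst iterate.simps) simp
  then show ?case
    using assms(1)
    by (auto simp: line_point_def displacement_def fun_eq_iff simp flip: sum_distrib_right)
qed

text \<open>The start lies on the linear piece, so the initial gap is L * (t - 1/2) and all powers
  of \<open>L\<close> cancel in the quotient.\<close>

lemma worst_case_ge:
  assumes "L > 0" "t \<ge> 1" "\<And>i. i < N \<Longrightarrow> displacement \<beta> i + 1 \<le> t"
  shows "ereal ((min (t - displacement \<beta> N) 1)\<^sup>2 / (t - 1 / 2)) \<le> worst_case L \<beta> N"
proof -
  define f where "f = line_huber L"
  have fx: "f (line_point t) = L * (t - 1 / 2)"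
    using assms(2) by (simp add: f_def line_huber_def huber_ge_1)
  have "f (line_point t) > min_value 1 f"
    using assms(1,2) fx by (simp add: f_def min_value_line_huber del: One_nat_def)
  then have "ereal ((norm_Rn 1 (gradient_Rn 1 f (iterate L \<beta> 1 f (line_point t) N)))\<^sup>2
      / (L * (f (line_point t) - min_value 1 f))) \<le> worst_case L \<beta> N"
    unfolding worst_case_def
    using line_huber_smooth_convex[OF assms(1)] line_point_in_Rn
    by (intro Sup_upper CollectI exI[of _ 1] exI[of _ f] exI[of _ "line_point t"] conjI refl)
      (simp_all add: f_def)
  moreover have "gradient_Rn 1 f (iterate L \<beta> 1 f (line_point t) N)
      = line_point (L * min (t - displacement \<beta> N) 1)"
    using assms iterate_line_huber[OF assms(1,3)] by (simp add: f_def gradient_line_huber del: One_nat_def)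
  ultimately show ?thesis
    using assms(1) fx
    by (simp add: f_def min_value_line_huber norm_Rn_Suc_0[folded One_nat_def] power_mult_distrib
        power2_eq_square del: One_nat_def)
qed

section \<open>Record displacements and the passage to the limit\<close>

lemma displacement_le_record: "i \<le> k \<Longrightarrow> displacement \<beta> i \<le> record_disp \<beta> k"
  by (simp add: record_disp_def)

lemma record_disp_nonneg: "0 \<le> record_disp \<beta> k"
  using displacement_le_record[of 0 k \<beta>] by (simp add: displacement_def)

text \<open>A running maximum can increase only through its newest term.\<close>

lemma displacement_eq_record:
  assumes "record_increment \<beta> N > 0"
  shows "displacement \<beta> N = record_disp \<beta> N"
proof (cases N)
  case 0
  then show ?thesis by (simp add: record_disp_def)
next
  case (Suc k)
  have "record_disp \<beta> N = max (displacement \<beta> N) (record_disp \<beta> k)"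
    by (simp add: record_disp_def Suc atLeast0_atMost_Suc)
  then show ?thesis using assms by (simp add: record_increment_def Suc max_def split: if_splits)
qed

lemma worst_case_ge_record:
  assumes "L > 0"
  shows "ereal (1 / (record_disp \<beta> N + 1 / 2)) \<le> worst_case L \<beta> N"
  using worst_case_ge[OF assms, of "record_disp \<beta> N + 1" N \<beta>]
    displacement_le_record[of _ N \<beta>] record_disp_nonneg[of \<beta> N]
  by (simp add: add.commute)

text \<open>The previous record is written as
  \<open>record_disp \<beta> N - record_increment \<beta> N\<close>, so that only sequences with
  known limits occur.\<close>

lemma worst_case_ge_overshoot:
  assumes "L > 0" "record_increment \<beta> N > 0"
  shows "ereal ((1 - record_increment \<beta> N)\<^sup>2 / (record_disp \<beta> N - record_increment \<beta> N + 1 / 2))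
    \<le> worst_case L \<beta> N"
  using worst_case_ge[OF assms(1), of "record_disp \<beta> (N - 1) + 1" N \<beta>]
    displacement_le_record[of _ "N - 1" \<beta>] record_disp_nonneg[of \<beta> "N - 1"]
    displacement_eq_record[OF assms(2)] assms(2)
  by (auto simp: min_def record_increment_def algebra_simps split: if_splits)

lemma Liminf_ge_of_tendsto:
  fixes u :: "nat \<Rightarrow> real" and w :: "nat \<Rightarrow> ereal"
  assumes "u \<longlonglongrightarrow> l" "c \<le> l" "\<forall>\<^sub>F n in sequentially. ereal (u n) \<le> w n"
  shows "ereal c \<le> liminf w"
proof -
  have "liminf (\<lambda>n. ereal (u n)) = ereal l"
    using assms(1) by (intro lim_imp_Liminf) auto
  then show ?thesis
    using Liminf_mono[OF assms(3)] assms(2) by (metis ereal_less_eq(3) order_trans)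
qed

theorem proposition3:
  fixes L a :: real and \<beta> :: "nat \<Rightarrow> nat \<Rightarrow> real"
  assumes "L > 0" and "a \<ge> 0"
    and "(\<lambda>N. record_disp \<beta> N / real N) \<longlonglongrightarrow> a"
    and "record_increment \<beta> \<longlonglongrightarrow> a"
  shows "liminf (\<lambda>N. ereal (real N) * worst_case L \<beta> N) \<ge> ereal (1 / 2)"
proof -
  have scale: "ereal (real N * r) \<le> ereal (real N) * worst_case L \<beta> N"
    if "ereal r \<le> worst_case L \<beta> N" for N r
    using ereal_mult_left_mono[OF that, of "ereal (real N)"] by simp
  show ?thesis
  proof (cases "a \<le> 2")
    case True
    define q where "q N = record_disp \<beta> N / real N + (1 / 2) / real N" for N
    have "q \<longlonglongrightarrow> a + 0"
      unfolding q_def by (intro tendsto_add assms(3) lim_const_over_n)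
    \<comment> \<open>Raising \<open>q N\<close> to at least 2 avoids division by zero in the limit
      when a = 0, and for a \<le> 2 the limit is exactly 1/2.\<close>
    then have lim: "(\<lambda>N. 1 / max (q N) 2) \<longlonglongrightarrow> 1 / max (a + 0) 2"
      by (intro tendsto_divide tendsto_max tendsto_const) auto
    show ?thesis
    proof (rule Liminf_ge_of_tendsto[OF lim])
      show "\<forall>\<^sub>F N in sequentially.
          ereal (1 / max (q N) 2) \<le> ereal (real N) * worst_case L \<beta> N"
        using eventually_gt_at_top[of 0]
      proof eventually_elim
        case (elim N)
        then have q: "q N = (record_disp \<beta> N + 1 / 2) / real N"
          by (simp add: q_def add_divide_distrib)
        then have "q N > 0" using elim record_disp_nonneg[of \<beta> N] by simp
        then have "1 / max (q N) 2 \<le> 1 / q N" by (intro divide_left_mono) auto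
        also have "\<dots> = real N * (1 / (record_disp \<beta> N + 1 / 2))" by (simp add: q)
        finally show ?case
          using scale[OF worst_case_ge_record[OF assms(1), of \<beta> N]]
          by (meson ereal_less_eq(3) order_trans)
      qed
    qed (use True in simp)
  next
    case False
    define \<Delta> where "\<Delta> = record_increment \<beta>"
    \<comment> \<open>The denominator of the overshoot bound divided by \<open>N\<close>; its limit
      is a > 2.\<close>
    define q where
      "q N = record_disp \<beta> N / real N - \<Delta> N * (1 / real N) + (1 / 2) / real N" for N
    have "q \<longlonglongrightarrow> a - a * 0 + 0"
      unfolding q_def \<Delta>_def
      by (intro tendsto_add tendsto_diff tendsto_mult assms(3,4) lim_const_over_n)
    then have lim: "(\<lambda>N. (1 - \<Delta> N)\<^sup>2 / q N) \<longlonglongrightarrow> (1 - a)\<^sup>2 / (a - a * 0 + 0)"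
      using False assms(4) unfolding \<Delta>_def
      by (intro tendsto_divide tendsto_power tendsto_diff tendsto_const) auto
    show ?thesis
    proof (rule Liminf_ge_of_tendsto[OF lim])
      \<comment> \<open>The product equals 2 * (1 - a)^2 - a.\<close>
      have "0 \<le> (a - 2) * (2 * a - 1)"
        using False by (intro mult_nonneg_nonneg) auto
      then show "1 / 2 \<le> (1 - a)\<^sup>2 / (a - a * 0 + 0)"
        using False by (simp add: field_simps power2_eq_square)
      \<comment> \<open>The increments tend to a > 2, so all late steps set records and the
        overshoot bound applies.\<close>
      have "\<forall>\<^sub>F N in sequentially. \<Delta> N > 0"
        using order_tendstoD(1)[OF assms(4), of 0] False by (simp add: \<Delta>_def)
      then show "\<forall>\<^sub>F N in sequentially.
          ereal ((1 - \<Delta> N)\<^sup>2 / q N) \<le> ereal (real N) * worst_case L \<beta> N"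
        using eventually_gt_at_top[of 0]
      proof eventually_elim
        case (elim N)
        then have "q N = (record_disp \<beta> N - \<Delta> N + 1 / 2) / real N"
          by (simp add: q_def add_divide_distrib diff_divide_distrib)
        then show ?case
          using scale[OF worst_case_ge_overshoot[OF assms(1), of \<beta> N]] elim
          by (simp add: \<Delta>_def mult.commute)
      qed
    qed
  qed
qed

end
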